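(* Let $n$ be a Carmichael number and let $p_1$ be its smallest prime factor. If $$1+\log_2 n-\left(\frac{(1+\log_2 n)^{\log_n (n/2)}-\log_2 n}{\bigl(\log_n (n/2)\bigr)\cdot (1+\log_2 n)^{\log_n (1/2)}-1}\right)\leq p_1,$$ then the proportion of the integers $a\in\{1,2,\ldots,n-1\}$ that are Fermat witnesses for $n$ is less than $50\%$, i.e. $$\frac{\bigl|\{a\in\{1,\ldots,n-1\} : a^{n-1}\not\equiv 1 \pmod n\}\bigr|}{n-1}<\frac12 .$$
   Context: A Carmichael number is a composite positive integer $n$ such that $a^{n-1}\equiv 1\pmod n$ for every positive integer $a$ with $\gcd(a,n)=1$. A Fermat witness for $n$ is an integer $a\in\{1,2,\ldots,n-1\}$ with $a^{n-1}\not\equiv 1\pmod n$. For $b>0$, $b\neq 1$ and $x>0$, $\log_b x=\ln x/\ln b$ is the real logarithm of $x$ to base $b$; thus $\log_n(n/2)$ and $\log_n(1/2)$ are the base-$n$ logarithms of $n/2$ and $1/2$. *)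

theory Defs
  imports Complex_Main "HOL-Number_Theory.Number_Theory"
begin

(* Not to be confused with the library constant Carmichael, which is Carmichael's lambda function. *)
definition carmichael_number :: "nat \<Rightarrow> bool" where
  "carmichael_number n \<longleftrightarrow>
     n > 1 \<and> \<not> prime n \<and> (\<forall>a::nat. a > 0 \<longrightarrow> coprime a n \<longrightarrow> [a ^ (n - 1) = 1] (mod n))"

definition fermat_witness :: "nat \<Rightarrow> nat \<Rightarrow> bool" where
  "fermat_witness n a \<longleftrightarrow> a \<in> {1..n - 1} \<and> \<not> [a ^ (n - 1) = 1] (mod n)"

end

theory Submission
  imports Defs "HOL-Analysis.Convex"
begin

text \<open>
  Let \<open>p\<close> be the least prime factor of \<open>n\<close>, let \<open>L = log\<^sub>2 n\<close> and \<open>c = 1 - 1/L = log\<^sub>n (n/2)\<close>. The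
  left-hand side of the hypothesis is one Newton step, started at \<open>1 + L\<close>, for the concave function
  \<open>g x = x\<^sup>c - (x - 1)\<close>, which is decreasing at \<open>1 + L\<close>. As \<open>g\<close> lies below its tangent, \<open>g p \<le> 0\<close>,
  that is \<open>1 - 1/p \<ge> p\<^bsup>-1/L\<^esup>\<close>. If \<open>n\<close> has \<open>k\<close> distinct prime factors, then \<open>p\<^sup>k \<le> n\<close> and therefore
  \<open>\<phi>(n)/n \<ge> (1 - 1/p)\<^sup>k \<ge> n\<^bsup>-1/L\<^esup> = 1/2\<close>. Finally, units modulo a Carmichael number are not witnesses.
\<close>

text \<open>Weighted AM-GM for \<open>x / x\<^sub>0\<close> and \<open>1\<close> with weights
  \<open>c\<close> and \<open>1 - c\<close>, scaled by \<open>x\<^sub>0 powr c\<close>, gives the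
  bound without any calculus.\<close>

lemma powr_le_tangent:
  fixes c x x\<^sub>0 :: real
  assumes "0 \<le> c" "c \<le> 1" "0 < x" "0 < x\<^sub>0"
  shows "x powr c \<le> x\<^sub>0 powr c + c * x\<^sub>0 powr (c - 1) * (x - x\<^sub>0)"
proof -
  have "(x / x\<^sub>0) powr c \<le> c * (x / x\<^sub>0) + (1 - c)"
    using Youngs_inequality_0[of c "1 - c" "x / x\<^sub>0" 1] assms by simp
  then have "x\<^sub>0 powr c * (x / x\<^sub>0) powr c \<le> x\<^sub>0 powr c * (c * (x / x\<^sub>0) + (1 - c))"
    by (intro mult_left_mono) auto
  also have "x\<^sub>0 powr c * (x / x\<^sub>0) powr c = x powr c"
    using assms by (simp add: powr_divide)
  also have "x\<^sub>0 powr c = x\<^sub>0 * x\<^sub>0 powr (c - 1)"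
    using assms by (simp add: powr_diff)
  also have "\<dots> * (c * (x / x\<^sub>0) + (1 - c)) = x\<^sub>0 * x\<^sub>0 powr (c - 1) + c * x\<^sub>0 powr (c - 1) * (x - x\<^sub>0)"
    using assms by (simp add: field_simps)
  also have "x\<^sub>0 * x\<^sub>0 powr (c - 1) = x\<^sub>0 powr c"
    using assms by (simp add: powr_diff)
  finally show ?thesis .
qed

lemma powr_le_pred_of_newton_step_le:
  fixes c x x\<^sub>0 :: real
  assumes c: "0 \<le> c" "c < 1" and x: "0 < x" and x\<^sub>0: "1 \<le> x\<^sub>0"
    and newton: "x\<^sub>0 - (x\<^sub>0 powr c - (x\<^sub>0 - 1)) / (c * x\<^sub>0 powr (c - 1) - 1) \<le> x"
  shows "x powr c \<le> x - 1"
proof -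
  \<comment> \<open>This is the slope of \<open>x powr c - (x - 1)\<close> at
    \<open>x\<^sub>0\<close>. It is at most \<open>c - 1 < 0\<close>, so clearing the denominator of
    the Newton step reverses the inequality.\<close>
  define d where "d = c * x\<^sub>0 powr (c - 1) - 1"
  have "x\<^sub>0 powr (c - 1) \<le> x\<^sub>0 powr 0"
    using c x\<^sub>0 by (intro powr_mono) auto
  then have "c * x\<^sub>0 powr (c - 1) \<le> c * 1"
    using c x\<^sub>0 by (intro mult_left_mono) auto
  with c have d: "d < 0" by (simp add: d_def)
  have "x\<^sub>0 - x \<le> (x\<^sub>0 powr c - (x\<^sub>0 - 1)) / d"
    using newton unfolding d_def by linarith
  then have "x\<^sub>0 powr c - (x\<^sub>0 - 1) \<le> (x\<^sub>0 - x) * d"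
    using d by (simp add: neg_le_divide_eq)
  moreover have "x powr c \<le> x\<^sub>0 powr c + c * x\<^sub>0 powr (c - 1) * (x - x\<^sub>0)"
    using powr_le_tangent[of c x x\<^sub>0] c x x\<^sub>0 by simp
  ultimately show ?thesis
    by (simp add: d_def algebra_simps)
qed

lemma prod_prime_factors_le:
  fixes n :: nat
  assumes "n > 0"
  shows "\<Prod>(prime_factors n) \<le> n"
proof -
  have "\<Prod>(prime_factors n) \<le> (\<Prod>p\<in>prime_factors n. p ^ multiplicity p n)"
  proof (rule prod_mono)
    fix p assume p: "p \<in> prime_factors n"
    then have "0 < multiplicity p n" "1 \<le> p"
      by (auto simp: prime_factors_multiplicity prime_gt_0_nat Suc_le_eq)
    then show "0 \<le> p \<and> p \<le> p ^ multiplicity p n"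
      using self_le_power by blast
  qed
  also have "\<dots> = n"
    using assms by (simp add: prod_prime_factors)
  finally show ?thesis .
qed

text \<open>In Euler's product for the totient, every factor \<open>1 - 1 / q\<close> is at least
  \<open>1 - 1 / p\<close>, which is nonnegative.\<close>

lemma totient_ge_power_prime_factors:
  fixes n p :: nat
  assumes "p > 0" and "\<And>q. q \<in> prime_factors n \<Longrightarrow> p \<le> q"
  shows "real n * (1 - 1 / real p) ^ card (prime_factors n) \<le> real (totient n)"
proof -
  have "(\<Prod>q\<in>prime_factors n. 1 - 1 / real p) \<le> (\<Prod>q\<in>prime_factors n. 1 - 1 / real q)"
    using assms by (intro prod_mono) (auto simp: frac_le)
  then show ?thesis
    by (simp add: totient_formula2 mult_left_mono)
qed

lemma totient_ge_half:
  fixes n p :: nat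
  assumes n: "n > 1" and p: "p > 1" and least: "\<And>q. q \<in> prime_factors n \<Longrightarrow> p \<le> q"
    and gap: "real p powr (1 - 1 / log 2 (real n)) \<le> real p - 1"
  shows "real n / 2 \<le> real (totient n)"
proof -
  define L where "L = log 2 (real n)"
  define k where "k = card (prime_factors n)"
  have L: "L > 0" using n by (simp add: L_def)
  have "p ^ k \<le> \<Prod>(prime_factors n)"
    unfolding k_def using prod_mono[of "prime_factors n" "\<lambda>_. p" "\<lambda>q. q"] least by simp
  also have "\<dots> \<le> n"
    using n by (intro prod_prime_factors_le) simp
  finally have pk: "real p ^ k \<le> real n"
    by (metis of_nat_le_iff of_nat_power)
  have "real p * real p powr (- 1 / L) \<le> real p - 1"
    using gap p by (simp add: L_def powr_diff powr_minus_divide)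
  then have step: "real p powr (- 1 / L) \<le> 1 - 1 / real p"
    using p by (simp add: field_simps)
  have "real n = 2 powr L"
    using n by (simp add: L_def)
  \<comment> \<open>The exponent \<open>- 1 / L\<close> is the one that sends \<open>n\<close> to
    \<open>1 / 2\<close>. Being negative, it reverses \<open>p ^ k \<le> n\<close> in the next
    step.\<close>
  then have "1 / 2 = real n powr (- 1 / L)"
    using L by (simp add: powr_powr powr_minus_divide)
  also have "\<dots> \<le> (real p ^ k) powr (- 1 / L)"
    using pk p L by (intro powr_mono2') auto
  also have "\<dots> = (real p powr (- 1 / L)) ^ k"
    using p by (simp add: powr_realpow[symmetric] powr_powr mult.commute)
  also have "\<dots> \<le> (1 - 1 / real p) ^ k"
    using step by (intro power_mono) auto
  finally have "real n * (1 / 2) \<le> real n * (1 - 1 / real p) ^ k"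
    by (intro mult_left_mono) auto
  also have "\<dots> \<le> real (totient n)"
    unfolding k_def using p least by (intro totient_ge_power_prime_factors) auto
  finally show ?thesis by simp
qed

text \<open>A witness cannot be coprime to \<open>n\<close>, so the witnesses lie in
  \<open>{1..n - 1}\<close> outside the totatives.\<close>

lemma card_fermat_witness_carmichael_le:
  assumes "carmichael_number n"
  shows "real (card {a. fermat_witness n a}) \<le> real n - 1 - real (totient n)"
proof -
  have n: "n > 1" using assms by (simp add: carmichael_number_def)
  have sub: "totatives n \<subseteq> {1..n - 1}"
  proof
    fix a assume a: "a \<in> totatives n"
    then have "a < n" "a \<noteq> 0"
      using totatives_less n by (auto intro!: Nat.gr0I)
    then show "a \<in> {1..n - 1}" by simp
  qed
  have "{a. fermat_witness n a} \<subseteq> {1..n - 1} - totatives n"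
    using assms by (auto simp: fermat_witness_def carmichael_number_def totatives_def)
  then have "card {a. fermat_witness n a} \<le> card ({1..n - 1} - totatives n)"
    by (intro card_mono) auto
  also have "\<dots> = n - 1 - totient n"
    using sub by (simp add: card_Diff_subset totient_def)
  finally have "card {a. fermat_witness n a} \<le> n - 1 - totient n" .
  \<comment> \<open>This keeps the truncated subtraction on naturals exact when passing to the
    reals.\<close>
  moreover have "totient n \<le> n - 1"
    using card_mono[OF _ sub] by (simp add: totient_def)
  ultimately show ?thesis using n by linarith
qed

theorem theorem1:
  fixes n p\<^sub>1 :: nat
  assumes "carmichael_number n"
    and "p\<^sub>1 = Min (prime_factors n)"
    and "1 + log 2 (real n)
           - (((1 + log 2 (real n)) powr (log (real n) (real n / 2)) - log 2 (real n))
              / (log (real n) (real n / 2) * (1 + log 2 (real n)) powr (log (real n) (1 / 2)) - 1))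
         \<le> real p\<^sub>1"
  shows "real (card {a. fermat_witness n a}) / (real n - 1) < 1 / 2"
proof -
  define L where "L = log 2 (real n)"
  have n: "n > 1" using assms(1) by (simp add: carmichael_number_def)
  have L: "L \<ge> 1" using n by (simp add: L_def le_log_iff)
  have half: "log (real n) (1 / 2) = - 1 / L"
    using n by (simp add: L_def log_def ln_div)
  have c: "log (real n) (real n / 2) = 1 - 1 / L"
    using n by (simp add: L_def log_def ln_div field_simps)
  have "prime_factors n \<noteq> {}"
    using n by (auto simp: prime_factorization_empty_iff)
  then have p_mem: "p\<^sub>1 \<in> prime_factors n"
    using assms(2) by simp
  then have p: "p\<^sub>1 > 1"
    using in_prime_factors_iff prime_gt_1_nat by blast
  have least: "p\<^sub>1 \<le> q" if "q \<in> prime_factors n" for q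
    using that assms(2) by simp
  \<comment> \<open>With \<open>c = 1 - 1 / L\<close>, the exponent
    \<open>log (real n) (1 / 2)\<close> is \<open>c - 1\<close>, and
    \<open>L = x\<^sub>0 - 1\<close>, so the hypothesis is a Newton step from \<open>1 + L\<close>.
    The bound \<open>L \<ge> 1\<close> gives \<open>c \<ge> 0\<close>.\<close>
  have "real p\<^sub>1 powr (1 - 1 / L) \<le> real p\<^sub>1 - 1"
    using assms(3) L p unfolding half c L_def[symmetric]
    by (intro powr_le_pred_of_newton_step_le[where x\<^sub>0 = "1 + L"]) auto
  then have "real n / 2 \<le> real (totient n)"
    using n p least by (intro totient_ge_half[of n p\<^sub>1]) (auto simp: L_def)
  \<comment> \<open>Strictness comes from excluding 0: at most \<open>n / 2 - 1\<close> witnesses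
    remain, and this is less than \<open>(n - 1) / 2\<close>.\<close>
  then show ?thesis
    using card_fermat_witness_carmichael_le[OF assms(1)] n by (simp add: field_simps)
qed

end
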